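(* Let $0<\alpha<\tfrac12$ and $d\in\mathbb R$ with $2d+2\alpha<1$. Then for every $t\in\mathbb R$, $$\mathbb E\, e^{tY_{\alpha,d}}<\infty\quad\Longleftrightarrow\quad t<\frac{1}{2\Lambda_2(\alpha,d)},$$ and $$\lim_{x\to\infty}\frac1x\log\mathbb P(Y_{\alpha,d}>x)=-\frac{1}{2\Lambda_2(\alpha,d)}.$$ The same logarithmic limit holds for the absolute value: $\lim_{x\to\infty}\frac1x\log\mathbb P(|Y_{\alpha,d}|>x)=-\frac{1}{2\Lambda_2(\alpha,d)}$.
   Context: For $0<\alpha<1/2$ and $d\in\mathbb R$ with $2d+2\alpha<1$, let $T=T_{\alpha,d}$ be the positive Hilbert--Schmidt operator on $L^2(0,1)$ (Lebesgue measure) $$(Tf)(x)=\int_0^1x^{-d/2}y^{-d/2}|x-y|^{-\alpha}f(y)\,dy,$$ with eigenvalues $\mu_1\ge\mu_2\ge\cdots>0$ (with multiplicity). Put $$I_{2,\alpha,d}=\int_0^1\!\!\int_0^1x^{-d}y^{-d}|x-y|^{-2\alpha}\,dx\,dy=\operatorname{tr}(T^2),\qquad a_j=\frac{\mu_j}{\sqrt{2I_{2,\alpha,d}}},$$ so $2\sum_j a_j^2=1$. The rank-two LIL constant is $$\Lambda_2(\alpha,d)=a_1=\frac{\lambda_{\max}(T_{\alpha,d})}{\sqrt{2I_{2,\alpha,d}}}.$$ The (sign-oriented, variance-one) weighted second-chaos limit $Y_{\alpha,d}$ is the random variable with the law $$Y_{\alpha,d}\stackrel{\mathrm{law}}=\sum_{j\ge1}a_j(Z_j^2-1),\qquad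 Z_j\text{ independent }N(0,1),$$ the series converging in $L^2$ and almost surely. *)

theory Defs
  imports "HOL-Probability.Probability"
begin

abbreviation unit_lborel :: "real measure" where
  "unit_lborel \<equiv> restrict_space lborel {0<..<1}"

text \<open>Elements of \<open>L\<^sup>2(0,1)\<close> are represented by functions; identification almost everywhere
  is made explicit wherever it matters.\<close>

definition L2_unit :: "(real \<Rightarrow> real) set" where
  "L2_unit = {f \<in> borel_measurable unit_lborel. integrable unit_lborel (\<lambda>x. (f x)\<^sup>2)}"

definition riesz_op :: "real \<Rightarrow> real \<Rightarrow> (real \<Rightarrow> real) \<Rightarrow> real \<Rightarrow> real" where
  "riesz_op \<alpha> d f x =
     (\<integral>y. x powr (-d/2) * y powr (-d/2) * \<bar>x - y\<bar> powr (-\<alpha>) * f y \<partial>unit_lborel)"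

definition eigenspace :: "real \<Rightarrow> real \<Rightarrow> real \<Rightarrow> (real \<Rightarrow> real) set" where
  "eigenspace \<alpha> d l = {f \<in> L2_unit. AE x in unit_lborel. riesz_op \<alpha> d f x = l * f x}"

definition is_eigenvalue :: "real \<Rightarrow> real \<Rightarrow> real \<Rightarrow> bool" where
  "is_eigenvalue \<alpha> d l \<longleftrightarrow>
     (\<exists>f\<in>eigenspace \<alpha> d l. \<not> (AE x in unit_lborel. f x = 0))"

definition L2_independent :: "nat \<Rightarrow> (nat \<Rightarrow> real \<Rightarrow> real) \<Rightarrow> bool" where
  "L2_independent n f \<longleftrightarrow>
     (\<forall>c :: nat \<Rightarrow> real. (AE x in unit_lborel. (\<Sum>i<n. c i * f i x) = 0) \<longrightarrow> (\<forall>i<n. c i = 0))"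

text \<open>Dimension of the eigenspace modulo equality almost everywhere.\<close>

definition eigen_dim :: "real \<Rightarrow> real \<Rightarrow> real \<Rightarrow> enat" where
  "eigen_dim \<alpha> d l =
     (SUP n \<in> {n. \<exists>f. (\<forall>i<n. f i \<in> eigenspace \<alpha> d l) \<and> L2_independent n f}. enat n)"

text \<open>The mathematical index \<open>j \<ge> 1\<close> is shifted to \<open>j \<ge> 0\<close>: \<open>\<mu> 0\<close> is the largest eigenvalue.
  The finiteness condition is needed because \<open>card\<close> is \<open>0\<close> on infinite sets.\<close>

definition eigenvalue_sequence :: "real \<Rightarrow> real \<Rightarrow> (nat \<Rightarrow> real) \<Rightarrow> bool" where
  "eigenvalue_sequence \<alpha> d \<mu> \<longleftrightarrow>
     decseq \<mu> \<and> (\<forall>j. 0 < \<mu> j) \<and>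
     (\<forall>l. l \<noteq> 0 \<longrightarrow> finite {j. \<mu> j = l} \<and> enat (card {j. \<mu> j = l}) = eigen_dim \<alpha> d l)"

definition I2 :: "real \<Rightarrow> real \<Rightarrow> real" where
  "I2 \<alpha> d = (\<integral>x. (\<integral>y. x powr (-d) * y powr (-d) * \<bar>x - y\<bar> powr (-2*\<alpha>)
     \<partial>unit_lborel) \<partial>unit_lborel)"

definition chaos_coeff :: "real \<Rightarrow> real \<Rightarrow> (nat \<Rightarrow> real) \<Rightarrow> nat \<Rightarrow> real" where
  "chaos_coeff \<alpha> d \<mu> j = \<mu> j / sqrt (2 * I2 \<alpha> d)"

definition lambda_max :: "real \<Rightarrow> real \<Rightarrow> real" where
  "lambda_max \<alpha> d = Sup {l. is_eigenvalue \<alpha> d l}"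

definition Lambda2 :: "real \<Rightarrow> real \<Rightarrow> real" where
  "Lambda2 \<alpha> d = lambda_max \<alpha> d / sqrt (2 * I2 \<alpha> d)"

end

theory Submission
  imports Defs "HOL-Real_Asymp.Real_Asymp"
begin

text \<open>
  Write \<open>a\<^sub>j = chaos_coeff \<alpha> d \<mu> j\<close>, so that \<open>W = \<Sum> a\<^sub>j (Z\<^sub>j\<^sup>2 - 1)\<close>. The exponential behaviour of such a
  series is governed by its largest coefficient \<open>a\<^sub>0\<close>. A centred chi-square variable has the
  Laplace transform
  \<open>E exp (s (Z\<^sup>2 - 1)) = sqrt (exp (- 2 s) / (1 - 2 s))\<close>, finite exactly for \<open>s < 1/2\<close>, and the
  logarithm of this factor is of order \<open>s\<^sup>2\<close> near \<open>0\<close>.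

  If \<open>\<Sum> a\<^sub>j\<^sup>2 < \<infinity>\<close> and \<open>2 t a\<^sub>0 < 1\<close>, the transforms of the partial sums are therefore bounded, and
  Fatou's lemma gives \<open>E exp (t W) < \<infinity>\<close> (\<open>nn_integral_exp_finite\<close>); Markov's inequality turns this
  into the upper tail bound. In the other direction, \<open>W = a\<^sub>0 (Z\<^sub>0\<^sup>2 - 1) + R\<close> with \<open>R\<close> independent of
  \<open>Z\<^sub>0\<close> (\<open>independent_remainder\<close>). Hence \<open>E exp (t W)\<close> factors and is infinite as soon as
  \<open>2 t a\<^sub>0 \<ge> 1\<close>, while \<open>P(W > x)\<close> is at least a positive constant times the Gaussian tail at
  \<open>sqrt (x / a\<^sub>0 + O(1))\<close> (\<open>upper_tail_ge\<close>), which decays at the rate \<open>1 / (2 a\<^sub>0)\<close>. The left tail of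
  \<open>W\<close> decays faster than every exponential, because the transform is finite for all negative
  arguments; so \<open>\<bar>W\<bar>\<close> has the same rate as \<open>W\<close>.

  The square summability of the coefficients is obtained from the almost sure convergence of the
  series (\<open>summable_squares\<close>), not from the Hilbert--Schmidt norm of the operator: were it to
  fail, the partial sums divided by their standard deviations would still tend to \<open>0\<close> almost surely, with
  exponential moments bounded away from those of the constant \<open>0\<close>.

  The operator enters only through two facts: its largest eigenvalue is \<open>\<mu> 0\<close> (\<open>lambda_max_eq\<close>), so that
  \<open>a\<^sub>0 = Lambda2 \<alpha> d\<close>, and the normalising integral \<open>I2 \<alpha> d\<close> is strictly positive (\<open>I2_pos\<close>).
  The second one requires integrability of the squared kernel, as a divergent
  Bochner integral has the value \<open>0\<close>.
\<close>

section \<open>Laplace transform of a centred chi-square variable\<close>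

text \<open>The square of the Laplace transform of \<open>Z\<^sup>2 - 1\<close> at \<open>u / 2\<close> is \<open>exp (- u) / (1 - u)\<close>. The linear term in
  \<open>u\<close> cancels, which is why square summability of the coefficients controls infinite products of
  these factors.\<close>

lemma exp_over_one_minus_le:
  fixes u :: real
  assumes "u < 1"
  shows "exp (- u) / (1 - u) \<le> exp (u\<^sup>2 / (1 - u))"
proof -
  have "1 / (1 - u) = 1 + u / (1 - u)"
    using assms by (simp add: field_simps)
  also have "\<dots> \<le> exp (u / (1 - u))"
    by (rule exp_ge_add_one_self)
  finally have "exp (- u) * (1 / (1 - u)) \<le> exp (- u) * exp (u / (1 - u))"
    by (intro mult_left_mono) auto
  also have "\<dots> = exp (u\<^sup>2 / (1 - u))"
    unfolding exp_add[symmetric] using assms by (simp add: field_simps power2_eq_square)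
  finally show ?thesis by simp
qed

text \<open>With \<open>u = - v\<close>, this shows that the quadratic order of the preceding bound is sharp; it detects a
  divergent sum of squares. The factor \<open>1/4\<close> is not optimal; it comes from
  the Taylor bound \<open>exp v \<ge> 1 + v + v\<^sup>2/2\<close> and \<open>1 + v \<le> 2\<close>.\<close>

lemma exp_over_one_plus_ge:
  fixes v :: real
  assumes "0 \<le> v" "v \<le> 1"
  shows "1 + v\<^sup>2 / 4 \<le> exp v / (1 + v)"
proof -
  have "(1 + v\<^sup>2 / 4) * (1 + v) = 1 + v + v\<^sup>2 / 4 * (1 + v)"
    by algebra
  also have "\<dots> \<le> 1 + v + v\<^sup>2 / 4 * 2"
    using assms by (intro add_left_mono mult_left_mono) auto
  also have "\<dots> \<le> exp v"
    using exp_lower_Taylor_quadratic[OF assms(1)] by simp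
  finally show ?thesis
    using assms by (simp add: field_simps)
qed

text \<open>Up to the factor \<open>\<sigma>\<close>, the integrand is again a Gaussian density, with variance
  \<open>\<sigma>\<^sup>2 = 1 / (1 - 2 s)\<close>.\<close>

lemma nn_integral_exp_square_std_normal:
  fixes s :: real
  assumes "s < 1 / 2"
  shows "(\<integral>\<^sup>+x. ennreal (std_normal_density x) * ennreal (exp (s * x\<^sup>2)) \<partial>lborel)
    = ennreal (1 / sqrt (1 - 2 * s))"
proof -
  define \<sigma> where "\<sigma> = 1 / sqrt (1 - 2 * s)"
  have \<sigma>: "\<sigma> > 0" "\<sigma>\<^sup>2 = 1 / (1 - 2 * s)"
    using assms by (auto simp: \<sigma>_def power_divide)
  have eq: "std_normal_density x * exp (s * x\<^sup>2) = \<sigma> * normal_density 0 \<sigma> x" for x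
  proof -
    have "x\<^sup>2 / (2 * \<sigma>\<^sup>2) = x\<^sup>2 * (1 / 2 - s)"
      by (simp add: \<sigma>(2))
    then have "- (x\<^sup>2 / 2) + s * x\<^sup>2 = - (x\<^sup>2 / (2 * \<sigma>\<^sup>2))"
      by (simp only:) (simp add: right_diff_distrib)
    then have "exp (- (x\<^sup>2 / 2)) * exp (s * x\<^sup>2) = exp (- (x\<^sup>2 / (2 * \<sigma>\<^sup>2)))"
      by (simp add: exp_add[symmetric])
    then show ?thesis
      using \<sigma>(1) by (simp add: normal_density_def real_sqrt_mult mult.assoc)
  qed
  interpret n: prob_space "density lborel (normal_density 0 \<sigma>)"
    using prob_space_normal_density[OF \<sigma>(1)] .
  have "(\<integral>\<^sup>+x. ennreal (normal_density 0 \<sigma> x) \<partial>lborel) = 1"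
    using n.emeasure_space_1 by (simp add: emeasure_density)
  moreover have "ennreal (std_normal_density x) * ennreal (exp (s * x\<^sup>2))
      = ennreal \<sigma> * ennreal (normal_density 0 \<sigma> x)" for x
    using \<sigma>(1) by (simp only: ennreal_mult'[symmetric] normal_density_nonneg less_imp_le eq)
  ultimately show ?thesis
    by (simp add: nn_integral_cmult flip: \<sigma>_def)
qed

lemma nn_integral_exp_square_std_normal_infinite:
  fixes s :: real
  assumes "1 / 2 \<le> s"
  shows "(\<integral>\<^sup>+x. ennreal (std_normal_density x) * ennreal (exp (s * x\<^sup>2)) \<partial>lborel) = \<infinity>"
proof -
  have "\<infinity> = (\<integral>\<^sup>+(x::real). ennreal (1 / sqrt (2 * pi)) \<partial>lborel)"
    by (simp add: ennreal_mult_eq_top_iff ennreal_mult_top)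
  also have "\<dots> \<le> (\<integral>\<^sup>+x. ennreal (std_normal_density x) * ennreal (exp (s * x\<^sup>2)) \<partial>lborel)"
  proof (intro nn_integral_mono)
    fix x :: real
    have "1 \<le> exp (- (x\<^sup>2 / 2) + s * x\<^sup>2)"
      using mult_right_mono[OF assms, of "x\<^sup>2"] by simp
    then show "ennreal (1 / sqrt (2 * pi)) \<le> ennreal (std_normal_density x) * ennreal (exp (s * x\<^sup>2))"
      unfolding exp_add by (simp add: ennreal_mult'[symmetric] std_normal_density_def divide_right_mono)
  qed
  finally show ?thesis
    by (simp add: top_unique)
qed

lemma sqrt_prod: "sqrt (\<Prod>i\<in>A. f i) = (\<Prod>i\<in>A. sqrt (f i))"
  by (induction A rule: infinite_finite_induct) (simp_all add: real_sqrt_mult)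

lemma one_plus_sum_le_prod_one_plus:
  fixes f :: "'b \<Rightarrow> real"
  assumes "\<And>i. i \<in> A \<Longrightarrow> 0 \<le> f i"
  shows "1 + sum f A \<le> (\<Prod>i\<in>A. 1 + f i)"
  using assms
proof (induction A rule: infinite_finite_induct)
  case (insert i A)
  have "1 + (f i + sum f A) \<le> (1 + f i) * (1 + sum f A)"
    using insert.prems by (simp add: algebra_simps sum_nonneg)
  also have "\<dots> \<le> (1 + f i) * (\<Prod>i\<in>A. 1 + f i)"
    using insert by (intro mult_left_mono) auto
  finally show ?case
    using insert.hyps by simp
qed simp_all

section \<open>Independent Gaussian sequences\<close>

locale gaussian_sequence = prob_space +
  fixes Z :: "nat \<Rightarrow> 'a \<Rightarrow> real"
  assumes indep: "indep_vars (\<lambda>_. borel) Z UNIV"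
    and normal: "\<And>j. distributed M lborel (Z j) std_normal_density"
begin

lemma random_variable_Z [measurable]: "random_variable borel (Z j)"
  using distributed_measurable[OF normal[of j]] by simp

lemma nn_integral_exp_centred_square_eq:
  "(\<integral>\<^sup>+\<omega>. ennreal (exp (s * ((Z j \<omega>)\<^sup>2 - 1))) \<partial>M)
    = ennreal (exp (- s)) * (\<integral>\<^sup>+x. ennreal (std_normal_density x) * ennreal (exp (s * x\<^sup>2)) \<partial>lborel)"
proof -
  have "exp (s * ((Z j \<omega>)\<^sup>2 - 1)) = exp (- s) * exp (s * (Z j \<omega>)\<^sup>2)" for \<omega>
    unfolding exp_add[symmetric] by (simp add: algebra_simps)
  then have "(\<integral>\<^sup>+\<omega>. ennreal (exp (s * ((Z j \<omega>)\<^sup>2 - 1))) \<partial>M)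
      = ennreal (exp (- s)) * (\<integral>\<^sup>+\<omega>. ennreal (exp (s * (Z j \<omega>)\<^sup>2)) \<partial>M)"
    by (simp add: ennreal_mult nn_integral_cmult)
  then show ?thesis
    using distributed_nn_integral[OF normal, of "\<lambda>x. ennreal (exp (s * x\<^sup>2))" j] by simp
qed

lemma nn_integral_exp_centred_square:
  assumes "2 * s < 1"
  shows "(\<integral>\<^sup>+\<omega>. ennreal (exp (s * ((Z j \<omega>)\<^sup>2 - 1))) \<partial>M)
    = ennreal (sqrt (exp (- (2 * s)) / (1 - 2 * s)))"
proof -
  have "sqrt (exp (- (2 * s))) = sqrt ((exp (- s))\<^sup>2)"
    unfolding exp_double[symmetric] by simp
  then have "sqrt (exp (- (2 * s)) / (1 - 2 * s)) = exp (- s) * (1 / sqrt (1 - 2 * s))"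
    by (simp add: real_sqrt_divide)
  moreover have "(\<integral>\<^sup>+x. ennreal (std_normal_density x) * ennreal (exp (s * x\<^sup>2)) \<partial>lborel)
      = ennreal (1 / sqrt (1 - 2 * s))"
    using assms by (intro nn_integral_exp_square_std_normal) simp
  ultimately show ?thesis
    unfolding nn_integral_exp_centred_square_eq by (simp only: ennreal_mult'[symmetric] exp_ge_zero)
qed

lemma nn_integral_exp_centred_square_infinite:
  assumes "1 \<le> 2 * s"
  shows "(\<integral>\<^sup>+\<omega>. ennreal (exp (s * ((Z j \<omega>)\<^sup>2 - 1))) \<partial>M) = \<infinity>"
  unfolding nn_integral_exp_centred_square_eq
  using assms by (subst nn_integral_exp_square_std_normal_infinite) (simp_all add: ennreal_mult_top)

lemma nn_integral_exp_partial_sum: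
  assumes "\<And>j. 2 * t * a j < 1"
  shows "(\<integral>\<^sup>+\<omega>. ennreal (exp (t * (\<Sum>j<n. a j * ((Z j \<omega>)\<^sup>2 - 1)))) \<partial>M)
    = ennreal (sqrt (\<Prod>j<n. exp (- (2 * t * a j)) / (1 - 2 * t * a j)))"
proof -
  have "(\<integral>\<^sup>+\<omega>. ennreal (exp (t * (\<Sum>j<n. a j * ((Z j \<omega>)\<^sup>2 - 1)))) \<partial>M)
      = (\<integral>\<^sup>+\<omega>. (\<Prod>j<n. ennreal (exp (t * a j * ((Z j \<omega>)\<^sup>2 - 1)))) \<partial>M)"
    by (simp add: prod_ennreal exp_sum sum_distrib_left mult.assoc)
  also have "\<dots> = (\<Prod>j<n. \<integral>\<^sup>+\<omega>. ennreal (exp (t * a j * ((Z j \<omega>)\<^sup>2 - 1))) \<partial>M)"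
    by (intro indep_vars_nn_integral
        indep_vars_compose2[OF indep_vars_subset[OF indep subset_UNIV]]) auto
  also have "\<dots> = (\<Prod>j<n. ennreal (sqrt (exp (- (2 * t * a j)) / (1 - 2 * t * a j))))"
    using assms by (intro prod.cong refl, subst nn_integral_exp_centred_square) (auto simp: mult.assoc)
  also have "\<dots> = ennreal (sqrt (\<Prod>j<n. exp (- (2 * t * a j)) / (1 - 2 * t * a j)))"
    unfolding sqrt_prod
    by (intro prod_ennreal real_sqrt_ge_zero divide_nonneg_nonneg)
      (simp_all add: less_imp_le[OF assms])
  finally show ?thesis .
qed

text \<open>Uniformity in the number of terms is the point: the bound depends on the partial sum only
  through the sum of the squared coefficients.\<close>

lemma nn_integral_exp_partial_sum_le:
  assumes u: "\<And>j. 2 * t * a j \<le> q" and q: "q < 1"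
  shows "(\<integral>\<^sup>+\<omega>. ennreal (exp (t * (\<Sum>j<n. a j * ((Z j \<omega>)\<^sup>2 - 1)))) \<partial>M)
    \<le> ennreal (exp (2 * t\<^sup>2 / (1 - q) * (\<Sum>j<n. (a j)\<^sup>2)))"
proof -
  have u1: "2 * t * a j < 1" for j
    using u[of j] q by linarith
  have "(\<Prod>j<n. exp (- (2 * t * a j)) / (1 - 2 * t * a j))
      \<le> (\<Prod>j<n. exp ((2 * t * a j)\<^sup>2 / (1 - q)))"
  proof (intro prod_mono conjI)
    fix j
    show "0 \<le> exp (- (2 * t * a j)) / (1 - 2 * t * a j)"
      using u1[of j] by simp
    have "exp (- (2 * t * a j)) / (1 - 2 * t * a j) \<le> exp ((2 * t * a j)\<^sup>2 / (1 - 2 * t * a j))"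
      by (rule exp_over_one_minus_le[OF u1])
    also have "\<dots> \<le> exp ((2 * t * a j)\<^sup>2 / (1 - q))"
      using u[of j] q by (simp add: divide_left_mono)
    finally show "exp (- (2 * t * a j)) / (1 - 2 * t * a j) \<le> exp ((2 * t * a j)\<^sup>2 / (1 - q))" .
  qed
  also have "\<dots> = (exp (2 * t\<^sup>2 / (1 - q) * (\<Sum>j<n. (a j)\<^sup>2)))\<^sup>2"
    by (simp add: exp_sum[symmetric] exp_double[symmetric] sum_distrib_left sum_divide_distrib power_mult_distrib mult_ac)
  finally show ?thesis
    unfolding nn_integral_exp_partial_sum[of t, OF u1]
    by (intro ennreal_leI real_le_lsqrt) auto
qed

end

section \<open>Series of centred chi-square variables\<close>

locale weighted_chi_square_series = gaussian_sequence +
  fixes a :: "nat \<Rightarrow> real" and W :: "'a \<Rightarrow> real"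
  assumes a_pos: "\<And>j. 0 < a j"
    and W_measurable [measurable]: "random_variable borel W"
    and series: "AE \<omega> in M. (\<lambda>j. a j * ((Z j \<omega>)\<^sup>2 - 1)) sums W \<omega>"
begin

text \<open>Suppose the sum of squares diverges, let \<open>\<sigma>\<^sub>n\<^sup>2\<close> be its partial sums and \<open>X\<^sub>n = - S\<^sub>n / (2 \<sigma>\<^sub>n)\<close>, where \<open>S\<^sub>n\<close>
  is the partial sum of the series. As \<open>S\<^sub>n\<close> converges and \<open>\<sigma>\<^sub>n\<close> tends to infinity, \<open>exp X\<^sub>n\<close> tends to
  \<open>1\<close> almost surely, and since \<open>E exp (2 X\<^sub>n)\<close> stays below \<open>e\<^sup>2 < 9\<close>, the means \<open>E exp X\<^sub>n\<close> cannot
  stay away from \<open>1\<close>. But \<open>(E exp X\<^sub>n)\<^sup>2\<close> is a product of factors \<open>exp v / (1 + v)\<close> with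
  \<open>\<Sum> v\<^sup>2 = 1\<close>, hence at least \<open>5/4\<close>. The minus sign in \<open>X\<^sub>n\<close> makes all exponential moments
  finite, whatever the size of the coefficients.\<close>

lemma summable_squares: "summable (\<lambda>j. (a j)\<^sup>2)"
proof (rule ccontr)
  assume not_summable: "\<not> summable (\<lambda>j. (a j)\<^sup>2)"
  define \<sigma> where "\<sigma> n = sqrt (\<Sum>j<n. (a j)\<^sup>2)" for n
  have \<sigma>_sq: "(\<sigma> n)\<^sup>2 = (\<Sum>j<n. (a j)\<^sup>2)" for n
    by (simp add: \<sigma>_def sum_nonneg)
  have \<sigma>_pos: "0 < \<sigma> n" if "1 \<le> n" for n
    unfolding \<sigma>_def using that a_pos by (auto intro!: sum_pos simp: less_imp_neq[symmetric] lessThan_empty_iff)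
  have "filterlim (\<lambda>n. \<Sum>j<n. (a j)\<^sup>2) at_top sequentially"
    unfolding filterlim_at_top
  proof
    fix B :: real
    obtain n where n: "B < (\<Sum>j<n. (a j)\<^sup>2)"
      using summableI_nonneg_bounded[of "\<lambda>j. (a j)\<^sup>2" B] not_summable
      by (metis not_le zero_le_power2)
    show "\<forall>\<^sub>F m in sequentially. B \<le> (\<Sum>j<m. (a j)\<^sup>2)"
      using eventually_ge_at_top[of n]
    proof eventually_elim
      case (elim m)
      then have "(\<Sum>j<n. (a j)\<^sup>2) \<le> (\<Sum>j<m. (a j)\<^sup>2)"
        by (intro sum_mono2) auto
      with n show ?case by simp
    qed
  qed
  then have "filterlim \<sigma> at_top sequentially"
    unfolding \<sigma>_def by (rule filterlim_compose[OF sqrt_at_top])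
  then have "(\<lambda>n. - (1 / 2) * (1 / \<sigma> n)) \<longlonglongrightarrow> - (1 / 2) * 0"
    by (intro tendsto_mult tendsto_const tendsto_divide_0[OF tendsto_const]
        filterlim_at_top_imp_at_infinity)
  then have \<theta>_0: "(\<lambda>n. - (1 / (2 * \<sigma> n))) \<longlonglongrightarrow> 0"
    by simp
  define X where "X n \<omega> = - (1 / (2 * \<sigma> n)) * (\<Sum>j<n. a j * ((Z j \<omega>)\<^sup>2 - 1))" for n \<omega>
  have [measurable]: "random_variable borel (X n)" for n
    unfolding X_def[abs_def] by measurable
  have "AE \<omega> in M. (\<lambda>n. ennreal (min (exp (X n \<omega>)) 100)) \<longlonglongrightarrow> ennreal (min (exp 0) 100)"
    using series
  proof eventually_elim
    case (elim \<omega>)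
    then have "(\<lambda>n. X n \<omega>) \<longlonglongrightarrow> 0 * W \<omega>"
      unfolding X_def sums_def by (intro tendsto_mult \<theta>_0)
    then show ?case
      by (intro tendsto_intros) simp_all
  qed
  \<comment> \<open>Uniform integrability is replaced by truncation at \<open>100\<close>: the excess is at most
    \<open>E exp (2 X\<^sub>n) / 100 \<le> 9/100\<close>, smaller than the gap \<open>1/10\<close> between \<open>11/10 \<le> sqrt (5/4)\<close> and \<open>1\<close>.\<close>
  then have lim: "(\<lambda>n. \<integral>\<^sup>+\<omega>. ennreal (min (exp (X n \<omega>)) 100) \<partial>M) \<longlonglongrightarrow> (\<integral>\<^sup>+\<omega>. ennreal (min (exp 0) 100) \<partial>M)"
    by (intro nn_integral_dominated_convergence[where w = "\<lambda>_. 100"])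
      (auto intro!: AE_I2 simp: ennreal_leI emeasure_space_1 simp flip: ennreal_numeral)
  have second_moment: "(\<integral>\<^sup>+\<omega>. ennreal (exp (2 * X n \<omega>)) \<partial>M) \<le> ennreal 9" if n: "1 \<le> n" for n
  proof -
    have "(\<integral>\<^sup>+\<omega>. ennreal (exp (2 * X n \<omega>)) \<partial>M)
        = (\<integral>\<^sup>+\<omega>. ennreal (exp (- (1 / \<sigma> n) * (\<Sum>j<n. a j * ((Z j \<omega>)\<^sup>2 - 1)))) \<partial>M)"
      by (simp add: X_def)
    also have "\<dots> \<le> ennreal (exp (2 * (- (1 / \<sigma> n))\<^sup>2 / (1 - 0) * (\<Sum>j<n. (a j)\<^sup>2)))"
      using \<sigma>_pos[OF n] a_pos
      by (intro nn_integral_exp_partial_sum_le) (auto simp: less_imp_le)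
    also have "2 * (- (1 / \<sigma> n))\<^sup>2 / (1 - 0) * (\<Sum>j<n. (a j)\<^sup>2) = (2::real)"
      using \<sigma>_pos[OF n] by (simp add: \<sigma>_sq[symmetric] power_divide)
    also have "exp 2 = (exp 1 :: real)\<^sup>2"
      by (simp add: exp_double[symmetric])
    also have "ennreal ((exp 1)\<^sup>2) \<le> ennreal (3\<^sup>2)"
      using exp_le by (intro ennreal_leI power_mono) auto
    finally show ?thesis by simp
  qed
  have first_moment: "ennreal (11 / 10) \<le> (\<integral>\<^sup>+\<omega>. ennreal (exp (X n \<omega>)) \<partial>M)" if n: "1 \<le> n" for n
  proof -
    define v where "v j = a j / \<sigma> n" for j
    have v_nonneg: "0 \<le> v j" for j
      using a_pos[of j] \<sigma>_pos[OF n] by (simp add: v_def)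
    have v_sum: "(\<Sum>j<n. (v j)\<^sup>2) = 1"
      using \<sigma>_pos[OF n] by (simp add: v_def power_divide sum_divide_distrib[symmetric] \<sigma>_sq[symmetric])
    have v_le: "v j \<le> 1" if "j < n" for j
    proof -
      have "(v j)\<^sup>2 \<le> (\<Sum>j<n. (v j)\<^sup>2)"
        using that by (intro member_le_sum) auto
      then show ?thesis
        using v_sum abs_le_square_iff[of "v j" 1] by simp
    qed
    have "(11 / 10)\<^sup>2 \<le> 1 + (\<Sum>j<n. (v j)\<^sup>2 / 4)"
      unfolding sum_divide_distrib[symmetric] v_sum by (simp add: power2_eq_square)
    also have "\<dots> \<le> (\<Prod>j<n. 1 + (v j)\<^sup>2 / 4)"
      by (rule one_plus_sum_le_prod_one_plus) simp
    also have "\<dots> \<le> (\<Prod>j<n. exp (v j) / (1 + v j))"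
      using v_nonneg v_le by (intro prod_mono conjI exp_over_one_plus_ge) auto
    finally have "11 / 10 \<le> sqrt (\<Prod>j<n. exp (v j) / (1 + v j))"
      by (intro real_le_rsqrt) simp
    also have "\<dots> = sqrt (\<Prod>j<n. exp (- (2 * (- (1 / (2 * \<sigma> n))) * a j)) / (1 - 2 * (- (1 / (2 * \<sigma> n))) * a j))"
      by (simp add: v_def)
    finally have "ennreal (11 / 10)
      \<le> ennreal (sqrt (\<Prod>j<n. exp (- (2 * (- (1 / (2 * \<sigma> n))) * a j)) / (1 - 2 * (- (1 / (2 * \<sigma> n))) * a j)))"
      by (rule ennreal_leI)
    moreover have "2 * (- (1 / (2 * \<sigma> n))) * a j < 1" for j
      using v_nonneg[of j] by (simp add: v_def)
    ultimately show ?thesis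
      unfolding X_def by (subst nn_integral_exp_partial_sum)
  qed
  have "ennreal (11 / 10) \<le> (\<integral>\<^sup>+\<omega>. ennreal (min (exp 0) 100) \<partial>M) + ennreal (9 / 100)"
  proof (rule LIMSEQ_le_const[OF tendsto_add[OF lim tendsto_const]], intro exI allI impI)
    fix n :: nat assume n: "1 \<le> n"
    have "ennreal (11 / 10) \<le> (\<integral>\<^sup>+\<omega>. ennreal (exp (X n \<omega>)) \<partial>M)"
      by (rule first_moment[OF n])
    also have "\<dots> \<le> (\<integral>\<^sup>+\<omega>. ennreal (min (exp (X n \<omega>)) 100) + ennreal (1 / 100) * ennreal (exp (2 * X n \<omega>)) \<partial>M)"
    proof (intro nn_integral_mono)
      fix \<omega>
      have "exp (X n \<omega>) \<le> min (exp (X n \<omega>)) 100 + 1 / 100 * (exp (X n \<omega>))\<^sup>2"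
      proof (cases "exp (X n \<omega>) \<le> 100")
        case False
        then have "exp (X n \<omega>) \<le> 1 / 100 * (exp (X n \<omega>))\<^sup>2"
          by (simp add: power2_eq_square)
        also have "\<dots> \<le> min (exp (X n \<omega>)) 100 + 1 / 100 * (exp (X n \<omega>))\<^sup>2"
          by simp
        finally show ?thesis .
      qed simp
      then show "ennreal (exp (X n \<omega>))
          \<le> ennreal (min (exp (X n \<omega>)) 100) + ennreal (1 / 100) * ennreal (exp (2 * X n \<omega>))"
        by (simp add: exp_double ennreal_leI ennreal_mult'[symmetric] ennreal_plus[symmetric] del: ennreal_plus)
    qed
    also have "\<dots> = (\<integral>\<^sup>+\<omega>. ennreal (min (exp (X n \<omega>)) 100) \<partial>M) + ennreal (1 / 100) * (\<integral>\<^sup>+\<omega>. ennreal (exp (2 * X n \<omega>)) \<partial>M)"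
      by (simp add: nn_integral_add nn_integral_cmult)
    also have "\<dots> \<le> (\<integral>\<^sup>+\<omega>. ennreal (min (exp (X n \<omega>)) 100) \<partial>M) + ennreal (1 / 100) * ennreal 9"
      by (intro add_left_mono mult_left_mono second_moment[OF n]) simp
    also have "ennreal (1 / 100) * ennreal 9 = ennreal (9 / 100)"
      by (subst ennreal_mult'[symmetric]) simp_all
    finally show "ennreal (11 / 10) \<le> (\<integral>\<^sup>+\<omega>. ennreal (min (exp (X n \<omega>)) 100) \<partial>M) + ennreal (9 / 100)" .
  qed
  also have "\<dots> = ennreal (1 + 9 / 100)"
    by (subst ennreal_plus) (simp_all add: emeasure_space_1)
  finally show False
    by (subst (asm) ennreal_le_iff) auto
qed

text \<open>Fatou's lemma transfers the uniform bound on the partial sums to the limit.\<close>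

lemma nn_integral_exp_finite:
  assumes u: "\<And>j. 2 * t * a j \<le> q" and q: "q < 1"
  shows "(\<integral>\<^sup>+\<omega>. ennreal (exp (t * W \<omega>)) \<partial>M) < \<infinity>"
proof -
  let ?S = "\<lambda>n \<omega>. \<Sum>j<n. a j * ((Z j \<omega>)\<^sup>2 - 1)"
  let ?C = "exp (2 * t\<^sup>2 / (1 - q) * (\<Sum>j. (a j)\<^sup>2))"
  have "(\<integral>\<^sup>+\<omega>. ennreal (exp (t * W \<omega>)) \<partial>M) = (\<integral>\<^sup>+\<omega>. liminf (\<lambda>n. ennreal (exp (t * ?S n \<omega>))) \<partial>M)"
  proof (intro nn_integral_cong_AE, use series in eventually_elim)
    case (elim \<omega>)
    then have "(\<lambda>n. ennreal (exp (t * ?S n \<omega>))) \<longlonglongrightarrow> ennreal (exp (t * W \<omega>))"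
      unfolding sums_def by (intro tendsto_intros)
    then show ?case
      by (rule lim_imp_Liminf[symmetric, OF trivial_limit_sequentially])
  qed
  also have "\<dots> \<le> liminf (\<lambda>n. \<integral>\<^sup>+\<omega>. ennreal (exp (t * ?S n \<omega>)) \<partial>M)"
    by (intro nn_integral_liminf) measurable
  also have "\<dots> \<le> liminf (\<lambda>n. ennreal ?C)"
  proof (intro Liminf_mono always_eventually allI)
    fix n
    have "(\<Sum>j<n. (a j)\<^sup>2) \<le> (\<Sum>j. (a j)\<^sup>2)"
      by (intro sum_le_suminf summable_squares) auto
    then have "ennreal (exp (2 * t\<^sup>2 / (1 - q) * (\<Sum>j<n. (a j)\<^sup>2))) \<le> ennreal ?C"
      using q by (intro ennreal_leI) (auto intro!: mult_left_mono divide_right_mono)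
    with nn_integral_exp_partial_sum_le[of t a q n, OF u q]
    show "(\<integral>\<^sup>+\<omega>. ennreal (exp (t * ?S n \<omega>)) \<partial>M) \<le> ennreal ?C"
      by (rule order_trans)
  qed
  also have "\<dots> < \<infinity>"
    by (simp add: Liminf_const)
  finally show ?thesis .
qed

text \<open>The remainder is a measurable function of \<open>(Z\<^sub>1, Z\<^sub>2, \<dots>)\<close>, hence independent of \<open>Z\<^sub>0\<close>; taking it as a
  \<open>suminf\<close> makes it measurable everywhere, including on the null set where the series
  diverges.\<close>

lemma independent_remainder:
  obtains R where "random_variable borel R" "indep_var borel (Z 0) borel R"
    "AE \<omega> in M. W \<omega> = a 0 * ((Z 0 \<omega>)\<^sup>2 - 1) + R \<omega>"
proof
  define R where "R \<omega> = (\<Sum>j. a (Suc j) * ((Z (Suc j) \<omega>)\<^sup>2 - 1))" for \<omega>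
  show "random_variable borel R"
    unfolding R_def[abs_def] by measurable
  have "indep_var borel ((\<lambda>f. f 0) \<circ> (\<lambda>\<omega>. restrict (\<lambda>i. Z i \<omega>) {0}))
    borel ((\<lambda>f. \<Sum>j. a (Suc j) * ((f (Suc j))\<^sup>2 - 1)) \<circ> (\<lambda>\<omega>. restrict (\<lambda>i. Z i \<omega>) {1..}))"
    by (rule indep_var_compose[OF indep_var_restrict[OF indep, of "{0}" "{1..}"]]) auto
  then show "indep_var borel (Z 0) borel R"
    by (simp add: comp_def R_def[abs_def])
  show "AE \<omega> in M. W \<omega> = a 0 * ((Z 0 \<omega>)\<^sup>2 - 1) + R \<omega>"
    using series
  proof eventually_elim
    case (elim \<omega>)
    then show ?case
      using suminf_split_head[OF sums_summable[OF elim]] sums_unique[OF elim]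
      by (simp add: R_def)
  qed
qed

lemma nn_integral_exp_infinite:
  assumes "1 \<le> 2 * t * a 0"
  shows "(\<integral>\<^sup>+\<omega>. ennreal (exp (t * W \<omega>)) \<partial>M) = \<infinity>"
proof -
  obtain R where R [measurable]: "random_variable borel R" and ind: "indep_var borel (Z 0) borel R"
    and W: "AE \<omega> in M. W \<omega> = a 0 * ((Z 0 \<omega>)\<^sup>2 - 1) + R \<omega>"
    by (rule independent_remainder)
  define f where "f = (\<lambda>z. ennreal (exp (t * a 0 * (z\<^sup>2 - 1)))) \<circ> Z 0"
  define g where "g = (\<lambda>r. ennreal (exp (t * r))) \<circ> R"
  have "indep_var borel f borel g"
    unfolding f_def g_def by (rule indep_var_compose[OF ind]) measurable
  then have ind_fg: "indep_vars (\<lambda>_. borel) (case_bool f g) UNIV"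
    unfolding indep_var_def by (rule back_subst[of "\<lambda>N. indep_vars N _ _"]) (auto split: bool.split)
  have "(\<integral>\<^sup>+\<omega>. ennreal (exp (t * W \<omega>)) \<partial>M) = (\<integral>\<^sup>+\<omega>. f \<omega> * g \<omega> \<partial>M)"
    using W by (intro nn_integral_cong_AE, eventually_elim)
      (simp add: f_def g_def ring_distribs exp_add ennreal_mult mult.assoc)
  also have "\<dots> = (\<integral>\<^sup>+\<omega>. f \<omega> \<partial>M) * (\<integral>\<^sup>+\<omega>. g \<omega> \<partial>M)"
    using indep_vars_nn_integral[OF _ ind_fg] by (simp add: UNIV_bool mult.commute)
  also have "(\<integral>\<^sup>+\<omega>. f \<omega> \<partial>M) = \<infinity>"
    using nn_integral_exp_centred_square_infinite[of "t * a 0" 0] assms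
    by (simp add: f_def mult.assoc)
  also have "\<infinity> * (\<integral>\<^sup>+\<omega>. g \<omega> \<partial>M) = \<infinity>"
  proof -
    have "(\<integral>\<^sup>+\<omega>. g \<omega> \<partial>M) \<noteq> 0"
      unfolding g_def by (subst nn_integral_0_iff_AE) (auto simp: AE_False)
    then show ?thesis
      by (simp add: ennreal_mult_eq_top_iff)
  qed
  finally show ?thesis .
qed

text \<open>The density is decreasing on the interval of length \<open>1\<close> to the right of \<open>s\<close>. This loses only a
  factor \<open>exp (O(s))\<close>, invisible on the logarithmic scale.\<close>

lemma normal_tail_ge:
  assumes "0 \<le> s"
  shows "std_normal_density (s + 1) \<le> prob {\<omega> \<in> space M. s < Z j \<omega>}"
proof -
  have "ennreal (std_normal_density (s + 1)) = (\<integral>\<^sup>+x. ennreal (std_normal_density (s + 1)) * indicator {s<..s+1} x \<partial>lborel)"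
    by (simp add: nn_integral_cmult)
  also have "\<dots> \<le> (\<integral>\<^sup>+x. ennreal (std_normal_density x) * indicator {s<..} x \<partial>lborel)"
  proof (intro nn_integral_mono)
    fix x :: real
    have "std_normal_density (s + 1) \<le> std_normal_density x" if "s < x" "x \<le> s + 1"
      using that assms by (auto simp: std_normal_density_def intro!: divide_right_mono power_mono)
    then show "ennreal (std_normal_density (s + 1)) * indicator {s<..s+1} x
        \<le> ennreal (std_normal_density x) * indicator {s<..} x"
      by (auto simp: indicator_def intro!: ennreal_leI)
  qed
  also have "\<dots> = emeasure M (Z j -` {s<..} \<inter> space M)"
    by (rule distributed_emeasure[OF normal, symmetric]) simp
  also have "Z j -` {s<..} \<inter> space M = {\<omega> \<in> space M. s < Z j \<omega>}"
    by auto
  finally show ?thesis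
    by (simp add: emeasure_eq_measure)
qed

text \<open>The event \<open>W > x\<close> contains the intersection of the independent events \<open>R > - c\<close> and
  \<open>a\<^sub>0 (Z\<^sub>0\<^sup>2 - 1) > x + c\<close>. The constant \<open>c\<close> is chosen so large that the first has positive
  probability.\<close>

lemma upper_tail_ge:
  obtains c p where "0 < p"
    "\<And>x. 0 \<le> x \<Longrightarrow> p * std_normal_density (sqrt ((x + c) / a 0 + 1) + 1) \<le> prob {\<omega> \<in> space M. x < W \<omega>}"
proof -
  obtain R where R [measurable]: "random_variable borel R" and ind: "indep_var borel (Z 0) borel R"
    and W: "AE \<omega> in M. W \<omega> = a 0 * ((Z 0 \<omega>)\<^sup>2 - 1) + R \<omega>"
    by (rule independent_remainder)
  have "\<exists>n. prob {\<omega> \<in> space M. - real n < R \<omega>} \<noteq> 0"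
  proof (rule ccontr)
    assume "\<nexists>n. prob {\<omega> \<in> space M. - real n < R \<omega>} \<noteq> 0"
    then have "AE \<omega> in M. \<forall>n. \<not> - real n < R \<omega>"
      by (auto simp: AE_all_countable prob_eq_0[symmetric] prob_eq_0)
    then have "AE \<omega> in M. False"
    proof eventually_elim
      case (elim \<omega>)
      obtain n where "- R \<omega> < real n" using reals_Archimedean2 by blast
      with elim show ?case by (metis minus_less_iff)
    qed
    then show False by (simp add: AE_False)
  qed
  then obtain n where n: "prob {\<omega> \<in> space M. - real n < R \<omega>} \<noteq> 0" ..
  show ?thesis
  proof (rule that[of "prob {\<omega> \<in> space M. - real n < R \<omega>}" "real n"])
    show "0 < prob {\<omega> \<in> space M. - real n < R \<omega>}"
      using n by (simp add: zero_less_measure_iff)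
    fix x :: real assume x: "0 \<le> x"
    define s where "s = sqrt ((x + real n) / a 0 + 1)"
    have s: "0 \<le> s" "s\<^sup>2 = (x + real n) / a 0 + 1"
      using x a_pos[of 0] by (auto simp: s_def add_nonneg_nonneg)
    have "prob {\<omega> \<in> space M. - real n < R \<omega>} * std_normal_density (s + 1)
        \<le> prob {\<omega> \<in> space M. - real n < R \<omega>} * prob {\<omega> \<in> space M. s < Z 0 \<omega>}"
      by (intro mult_left_mono normal_tail_ge s) simp
    also have "\<dots> = prob ((\<lambda>\<omega>. (Z 0 \<omega>, R \<omega>)) -` ({s<..} \<times> {- real n<..}) \<inter> space M)"
      by (subst indep_varD[OF ind]) (auto simp: vimage_def Int_def conj_commute)
    also have "\<dots> \<le> prob {\<omega> \<in> space M. x < W \<omega>}"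
    proof (rule finite_measure_mono_AE, use W in eventually_elim)
      case (elim \<omega>)
      have "x < a 0 * ((Z 0 \<omega>)\<^sup>2 - 1) + R \<omega>" if "s < Z 0 \<omega>" "- real n < R \<omega>"
      proof -
        have "s\<^sup>2 \<le> (Z 0 \<omega>)\<^sup>2"
          using that s by (intro power_mono) auto
        then have "a 0 * (s\<^sup>2 - 1) \<le> a 0 * ((Z 0 \<omega>)\<^sup>2 - 1)"
          using a_pos[of 0] by (intro mult_left_mono) auto
        moreover have "a 0 * (s\<^sup>2 - 1) = x + real n"
          using a_pos[of 0] by (simp add: s)
        ultimately show ?thesis using that by linarith
      qed
      with elim show ?case by auto
    qed measurable
    finally show "prob {\<omega> \<in> space M. - real n < R \<omega>} * std_normal_density (sqrt ((x + real n) / a 0 + 1) + 1)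
        \<le> prob {\<omega> \<in> space M. x < W \<omega>}"
      unfolding s_def .
  qed
qed

end

section \<open>Logarithmic tail asymptotics\<close>

text \<open>The upper bounds are available for every rate strictly below \<open>L\<close> only, with constants that may blow up
  as the rate approaches \<open>L\<close>; on the logarithmic scale this suffices. Strict positivity of the lower bound
  \<open>l\<close> matters because of the convention \<open>ln 0 = 0\<close>.\<close>

lemma log_tail_limit:
  fixes P l :: "real \<Rightarrow> real"
  assumes "0 < L"
    and upper: "\<And>t. 0 < t \<Longrightarrow> t < L \<Longrightarrow> \<exists>C>0. \<forall>x. P x \<le> C * exp (- t * x)"
    and lower: "\<forall>\<^sub>F x in at_top. 0 < l x \<and> l x \<le> P x"
    and l: "((\<lambda>x. 1 / x * ln (l x)) \<longlongrightarrow> - L) at_top"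
  shows "((\<lambda>x. 1 / x * ln (P x)) \<longlongrightarrow> - L) at_top"
proof (rule order_tendstoI)
  fix b assume "b < - L"
  then have "\<forall>\<^sub>F x in at_top. b < 1 / x * ln (l x)"
    by (rule order_tendstoD(1)[OF l])
  then show "\<forall>\<^sub>F x in at_top. b < 1 / x * ln (P x)"
    using lower eventually_gt_at_top[of 0]
  proof eventually_elim
    case (elim x)
    then have "1 / x * ln (l x) \<le> 1 / x * ln (P x)"
      by (intro mult_left_mono) (auto simp: ln_le_cancel_iff)
    with elim show ?case by simp
  qed
next
  fix b assume "- L < b"
  then have "max 0 (- b) < L"
    using \<open>0 < L\<close> by simp
  then obtain t where t: "max 0 (- b) < t" "t < L"
    using dense by blast
  then obtain C where C: "0 < C" "\<And>x. P x \<le> C * exp (- t * x)"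
    using upper[of t] by auto
  have "((\<lambda>x. ln C / x - t) \<longlongrightarrow> - t) at_top"
    by real_asymp
  then have "\<forall>\<^sub>F x in at_top. ln C / x - t < b"
    using t by (intro order_tendstoD(2)) auto
  then show "\<forall>\<^sub>F x in at_top. 1 / x * ln (P x) < b"
    using lower eventually_gt_at_top[of 0]
  proof eventually_elim
    case (elim x)
    have "ln (P x) \<le> ln (C * exp (- t * x))"
      using elim C(2)[of x] by (intro ln_mono) auto
    also have "\<dots> = ln C - t * x"
      using C(1) by (simp add: ln_mult)
    finally have "1 / x * ln (P x) \<le> 1 / x * (ln C - t * x)"
      using elim by (intro mult_left_mono) auto
    also have "\<dots> = ln C / x - t"
      using elim by (simp add: field_simps)
    finally show ?case
      using elim by simp
  qed
qed

lemma (in prob_space) prob_greater_le_exp_moment: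
  fixes V :: "'a \<Rightarrow> real"
  assumes [measurable]: "random_variable borel V" and t: "0 < t"
    and fin: "(\<integral>\<^sup>+\<omega>. ennreal (exp (t * V \<omega>)) \<partial>M) < \<infinity>"
  shows "prob {\<omega> \<in> space M. x < V \<omega>} \<le> enn2real (\<integral>\<^sup>+\<omega>. ennreal (exp (t * V \<omega>)) \<partial>M) * exp (- t * x)"
proof -
  have "emeasure M {\<omega> \<in> space M. x < V \<omega>} = (\<integral>\<^sup>+\<omega>. indicator {\<omega> \<in> space M. x < V \<omega>} \<omega> \<partial>M)"
    by simp
  also have "\<dots> \<le> (\<integral>\<^sup>+\<omega>. ennreal (exp (- t * x)) * ennreal (exp (t * V \<omega>)) \<partial>M)"
  proof (intro nn_integral_mono)
    fix \<omega>
    have "1 \<le> exp (- t * x) * exp (t * V \<omega>)" if "x < V \<omega>"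
      using that t unfolding exp_add[symmetric] by simp
    then show "indicator {\<omega> \<in> space M. x < V \<omega>} \<omega> \<le> ennreal (exp (- t * x)) * ennreal (exp (t * V \<omega>))"
      by (auto simp: indicator_def ennreal_mult'[symmetric])
  qed
  also have "\<dots> = ennreal (exp (- t * x)) * (\<integral>\<^sup>+\<omega>. ennreal (exp (t * V \<omega>)) \<partial>M)"
    by (simp add: nn_integral_cmult)
  also have "\<dots> = ennreal (exp (- t * x)) * ennreal (enn2real (\<integral>\<^sup>+\<omega>. ennreal (exp (t * V \<omega>)) \<partial>M))"
    using fin by simp
  also have "\<dots> = ennreal (enn2real (\<integral>\<^sup>+\<omega>. ennreal (exp (t * V \<omega>)) \<partial>M) * exp (- t * x))"
    by (simp add: ennreal_mult mult.commute)
  finally show ?thesis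
    by (simp add: emeasure_eq_measure)
qed

locale decreasing_chi_square_series = weighted_chi_square_series +
  assumes decreasing: "decseq a"
begin

lemma a_le_a_0: "a j \<le> a 0"
  using decreasing by (auto simp: decseq_def)

lemma nn_integral_exp_finite_iff:
  "(\<integral>\<^sup>+\<omega>. ennreal (exp (t * W \<omega>)) \<partial>M) < \<infinity> \<longleftrightarrow> t < 1 / (2 * a 0)"
proof
  assume "(\<integral>\<^sup>+\<omega>. ennreal (exp (t * W \<omega>)) \<partial>M) < \<infinity>"
  then have "2 * t * a 0 < 1"
    using nn_integral_exp_infinite[of t] by (auto simp: not_le[symmetric])
  then show "t < 1 / (2 * a 0)"
    using a_pos[of 0] by (simp add: field_simps)
next
  assume t: "t < 1 / (2 * a 0)"
  show "(\<integral>\<^sup>+\<omega>. ennreal (exp (t * W \<omega>)) \<partial>M) < \<infinity>"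
  proof (rule nn_integral_exp_finite)
    \<comment> \<open>For \<open>t < 0\<close> all products \<open>t * a j\<close> are negative and the bound \<open>0\<close> serves.\<close>
    show "max 0 (2 * t * a 0) < 1"
      using t a_pos[of 0] by (simp add: field_simps)
    fix j
    show "2 * t * a j \<le> max 0 (2 * t * a 0)"
    proof (cases "0 \<le> t")
      case True
      then have "2 * t * a j \<le> 2 * t * a 0"
        using a_le_a_0 by (intro mult_left_mono) auto
      then show ?thesis by simp
    next
      case False
      then have "2 * t * a j \<le> 0"
        using a_pos[of j] by (simp add: mult_le_0_iff)
      then show ?thesis by simp
    qed
  qed
qed

lemma upper_tail_limits:
  shows "((\<lambda>x. 1 / x * ln (prob {\<omega> \<in> space M. x < W \<omega>})) \<longlongrightarrow> - (1 / (2 * a 0))) at_top"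
    and "((\<lambda>x. 1 / x * ln (prob {\<omega> \<in> space M. x < \<bar>W \<omega>\<bar>})) \<longlongrightarrow> - (1 / (2 * a 0))) at_top"
proof -
  define L where "L = 1 / (2 * a 0)"
  have L: "0 < L"
    using a_pos[of 0] by (simp add: L_def)
  obtain c p where p: "0 < p"
    and tail: "\<And>x. 0 \<le> x \<Longrightarrow> p * std_normal_density (sqrt ((x + c) / a 0 + 1) + 1) \<le> prob {\<omega> \<in> space M. x < W \<omega>}"
    by (rule upper_tail_ge) blast
  define l where "l x = p * std_normal_density (sqrt ((x + c) / a 0 + 1) + 1)" for x
  have l_pos: "0 < l x" for x
    using p by (simp add: l_def normal_density_pos)
  have "ln (l x) = ln p - ln (sqrt (2 * pi)) - (sqrt ((x + c) / a 0 + 1) + 1)\<^sup>2 / 2" for x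
    using p by (simp add: l_def std_normal_density_def ln_mult ln_div)
  moreover have "((\<lambda>x. 1 / x * (k - (sqrt ((x + c) / a 0 + 1) + 1)\<^sup>2 / 2)) \<longlongrightarrow> - (1 / (2 * a 0))) at_top" for k
  proof -
    have "((\<lambda>x. 1 / x * (k - (sqrt ((x + c) / a 0 + 1) + 1)\<^sup>2 / 2))
        \<longlongrightarrow> - ((inverse (a 0) powr (1 / 2))\<^sup>2 / 2)) at_top"
      using a_pos[of 0] by real_asymp
    then show ?thesis
      using a_pos[of 0] by (simp add: powr_half_sqrt inverse_eq_divide mult.commute)
  qed
  ultimately have l: "((\<lambda>x. 1 / x * ln (l x)) \<longlongrightarrow> - L) at_top"
    by (simp add: L_def)
  have lower: "\<forall>\<^sub>F x in at_top. 0 < l x \<and> l x \<le> prob {\<omega> \<in> space M. x < W \<omega>}"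
    using eventually_ge_at_top[of 0] by eventually_elim (use l_pos tail in \<open>auto simp: l_def\<close>)
  have lower_abs: "\<forall>\<^sub>F x in at_top. 0 < l x \<and> l x \<le> prob {\<omega> \<in> space M. x < \<bar>W \<omega>\<bar>}"
    using lower
  proof eventually_elim
    case (elim x)
    moreover have "prob {\<omega> \<in> space M. x < W \<omega>} \<le> prob {\<omega> \<in> space M. x < \<bar>W \<omega>\<bar>}"
      by (rule finite_measure_mono) auto
    ultimately show ?case by simp
  qed
  define E where "E t = enn2real (\<integral>\<^sup>+\<omega>. ennreal (exp (t * W \<omega>)) \<partial>M)" for t
  have right: "prob {\<omega> \<in> space M. x < W \<omega>} \<le> E t * exp (- t * x)" if "0 < t" "t < L" for t x
    unfolding E_def using that nn_integral_exp_finite_iff[of t]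
    by (intro prob_greater_le_exp_moment) (auto simp: L_def)
  have left: "prob {\<omega> \<in> space M. x < - W \<omega>} \<le> E (- t) * exp (- t * x)" if "0 < t" "t < L" for t x
  proof -
    have "- t < L" using that L by simp
    then show ?thesis
      using prob_greater_le_exp_moment[of "\<lambda>\<omega>. - W \<omega>" t x] that nn_integral_exp_finite_iff[of "- t"]
      by (simp add: E_def L_def)
  qed
  have E_nonneg: "0 \<le> E t" for t
    by (simp add: E_def)
  show "((\<lambda>x. 1 / x * ln (prob {\<omega> \<in> space M. x < W \<omega>})) \<longlongrightarrow> - (1 / (2 * a 0))) at_top"
    unfolding L_def[symmetric]
  proof (rule log_tail_limit[OF L _ lower l])
    fix t assume t: "0 < t" "t < L"
    \<comment> \<open>Adding \<open>1\<close> makes the constant evidently positive.\<close>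
    have "prob {\<omega> \<in> space M. x < W \<omega>} \<le> (E t + 1) * exp (- t * x)" for x
      using right[OF t, of x] by (simp add: distrib_right add_increasing2)
    then show "\<exists>C>0. \<forall>x. prob {\<omega> \<in> space M. x < W \<omega>} \<le> C * exp (- t * x)"
      using E_nonneg[of t] by (intro exI[of _ "E t + 1"]) auto
  qed
  show "((\<lambda>x. 1 / x * ln (prob {\<omega> \<in> space M. x < \<bar>W \<omega>\<bar>})) \<longlongrightarrow> - (1 / (2 * a 0))) at_top"
    unfolding L_def[symmetric]
  proof (rule log_tail_limit[OF L _ lower_abs l])
    fix t assume t: "0 < t" "t < L"
    have "prob {\<omega> \<in> space M. x < \<bar>W \<omega>\<bar>} \<le> (E t + E (- t) + 1) * exp (- t * x)" for x
    proof -
      have "{\<omega> \<in> space M. x < \<bar>W \<omega>\<bar>} = {\<omega> \<in> space M. x < W \<omega>} \<union> {\<omega> \<in> space M. x < - W \<omega>}"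
        by (auto simp: abs_if)
      also have "prob \<dots> \<le> prob {\<omega> \<in> space M. x < W \<omega>} + prob {\<omega> \<in> space M. x < - W \<omega>}"
        by (rule measure_Un_le) measurable
      also have "\<dots> \<le> E t * exp (- t * x) + E (- t) * exp (- t * x)"
        by (rule add_mono[OF right[OF t] left[OF t]])
      also have "\<dots> \<le> (E t + E (- t) + 1) * exp (- t * x)"
        by (simp add: distrib_right)
      finally show ?thesis .
    qed
    then show "\<exists>C>0. \<forall>x. prob {\<omega> \<in> space M. x < \<bar>W \<omega>\<bar>} \<le> C * exp (- t * x)"
      using E_nonneg[of t] E_nonneg[of "- t"] by (intro exI[of _ "E t + E (- t) + 1"]) auto
  qed
qed

end

section \<open>The largest eigenvalue\<close>

lemma eigen_dim_ne_0_iff_is_eigenvalue: "eigen_dim \<alpha> d l \<noteq> 0 \<longleftrightarrow> is_eigenvalue \<alpha> d l"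
proof
  assume "eigen_dim \<alpha> d l \<noteq> 0"
  have "\<exists>n f. n \<noteq> 0 \<and> (\<forall>i<n. f i \<in> eigenspace \<alpha> d l) \<and> L2_independent n f"
  proof (rule ccontr)
    assume "\<not> ?thesis"
    then have "eigen_dim \<alpha> d l \<le> 0"
      unfolding eigen_dim_def by (intro SUP_least) (auto simp: enat_0_iff)
    with \<open>eigen_dim \<alpha> d l \<noteq> 0\<close> show False by simp
  qed
  then obtain n f where "n \<noteq> 0" and f: "\<forall>i<n. f i \<in> eigenspace \<alpha> d l" "L2_independent n f"
    by blast
  have "\<not> (AE x in unit_lborel. f 0 x = 0)"
  proof
    assume zero: "AE x in unit_lborel. f 0 x = 0"
    define c :: "nat \<Rightarrow> real" where "c i = (if i = 0 then 1 else 0)" for i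
    have "(\<Sum>i<n. c i * f i x) = (\<Sum>i<n. if i = 0 then f i x else 0)" for x
      by (intro sum.cong) (auto simp: c_def)
    then have "(\<Sum>i<n. c i * f i x) = f 0 x" for x
      using \<open>n \<noteq> 0\<close> by simp
    then have "\<forall>i<n. c i = 0"
      using f(2)[unfolded L2_independent_def, THEN spec[of _ c]] zero by simp
    then show False
      using \<open>n \<noteq> 0\<close> by (auto simp: c_def)
  qed
  with f(1) \<open>n \<noteq> 0\<close> show "is_eigenvalue \<alpha> d l"
    unfolding is_eigenvalue_def by blast
next
  assume "is_eigenvalue \<alpha> d l"
  then obtain g where g: "g \<in> eigenspace \<alpha> d l" "\<not> (AE x in unit_lborel. g x = 0)"
    unfolding is_eigenvalue_def by blast
  have "L2_independent 1 (\<lambda>_. g)"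
    unfolding L2_independent_def using g(2) by auto
  then have "enat 1 \<le> eigen_dim \<alpha> d l"
    unfolding eigen_dim_def using g(1) by (intro SUP_upper) auto
  then show "eigen_dim \<alpha> d l \<noteq> 0"
    by (auto simp: enat_0_iff)
qed

lemma is_eigenvalue_iff_in_range:
  assumes "eigenvalue_sequence \<alpha> d \<mu>" and "l \<noteq> 0"
  shows "is_eigenvalue \<alpha> d l \<longleftrightarrow> l \<in> range \<mu>"
proof -
  have "finite {j. \<mu> j = l}" and "enat (card {j. \<mu> j = l}) = eigen_dim \<alpha> d l"
    using assms unfolding eigenvalue_sequence_def by auto
  then have "is_eigenvalue \<alpha> d l \<longleftrightarrow> {j. \<mu> j = l} \<noteq> {}"
    unfolding eigen_dim_ne_0_iff_is_eigenvalue[symmetric]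
    by (metis card_eq_0_iff enat_0_iff(1))
  then show ?thesis by auto
qed

text \<open>The value \<open>0\<close> may or may not be an eigenvalue, since the eigenvalue sequence only records the others;
  being smaller than \<open>\<mu> 0\<close>, it does not affect the supremum.\<close>

lemma lambda_max_eq:
  assumes "eigenvalue_sequence \<alpha> d \<mu>"
  shows "lambda_max \<alpha> d = \<mu> 0"
  unfolding lambda_max_def
proof (rule cSup_eq_maximum)
  have \<mu>: "0 < \<mu> j" "\<mu> j \<le> \<mu> 0" for j
    using assms by (auto simp: eigenvalue_sequence_def decseq_def)
  show "\<mu> 0 \<in> {l. is_eigenvalue \<alpha> d l}"
    using is_eigenvalue_iff_in_range[OF assms] \<mu>(1)[of 0] by auto
  fix l assume "l \<in> {l. is_eigenvalue \<alpha> d l}"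
  then show "l \<le> \<mu> 0"
    using is_eigenvalue_iff_in_range[OF assms, of l] \<mu> by (cases "l = 0") (auto intro: less_imp_le)
qed

section \<open>Positivity of the normalising integral\<close>

lemma nn_integral_powr_unit:
  fixes s :: real
  assumes "s < 1"
  shows "(\<integral>\<^sup>+y. ennreal (y powr (- s)) \<partial>unit_lborel) = ennreal (1 / (1 - s))"
proof -
  have "((\<lambda>y. y powr (- s)) has_integral (1 powr (- s + 1) / (- s + 1))) {0..1}"
    using assms by (intro has_integral_powr_from_0) auto
  then have "((\<lambda>y. if y \<in> {0..1} then y powr (- s) else 0) has_integral (1 / (1 - s))) UNIV"
    by (simp add: has_integral_restrict_UNIV del: atLeastAtMost_iff)
  then have "(\<integral>\<^sup>+y. ennreal (if y \<in> {0..1} then y powr (- s) else 0) \<partial>lborel) = ennreal (1 / (1 - s))"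
    by (intro nn_integral_has_integral_lborel) auto
  moreover have "(\<integral>\<^sup>+y. ennreal (if y \<in> {0..1} then y powr (- s) else 0) \<partial>lborel)
      = (\<integral>\<^sup>+y. ennreal (y powr (- s)) * indicator {0<..<1} y \<partial>lborel)"
    by (intro nn_integral_cong_AE, use AE_lborel_singleton[of 0] AE_lborel_singleton[of 1] in eventually_elim)
      (auto simp: indicator_def)
  ultimately show ?thesis
    by (simp add: nn_integral_restrict_space)
qed

text \<open>Splitting at \<open>y = x\<close>, each half is a translate or reflection of a part of \<open>u powr (- s)\<close> on the unit
  interval. The bound is uniform in \<open>x\<close>.\<close>

lemma nn_integral_powr_diff_unit_le:
  fixes s x :: real
  assumes "s < 1" and x: "0 < x" "x < 1"
  shows "(\<integral>\<^sup>+y. ennreal (\<bar>x - y\<bar> powr (- s)) \<partial>unit_lborel) \<le> ennreal (2 / (1 - s))"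
proof -
  let ?h = "\<lambda>u. ennreal (u powr (- s)) * indicator {0<..<1} u"
  have h: "(\<integral>\<^sup>+u. ?h u \<partial>lborel) = ennreal (1 / (1 - s))"
    using nn_integral_powr_unit[OF assms(1)] by (simp add: nn_integral_restrict_space)
  have affine: "(\<integral>\<^sup>+y. ?h (x + - 1 * y) \<partial>lborel) = ennreal (1 / (1 - s))"
    "(\<integral>\<^sup>+y. ?h (- x + 1 * y) \<partial>lborel) = ennreal (1 / (1 - s))"
    using nn_integral_real_affine[of ?h "- 1" x] nn_integral_real_affine[of ?h 1 "- x"] h by simp_all
  have "(\<integral>\<^sup>+y. ennreal (\<bar>x - y\<bar> powr (- s)) \<partial>unit_lborel)
      = (\<integral>\<^sup>+y. ennreal (\<bar>x - y\<bar> powr (- s)) * indicator {0<..<1} y \<partial>lborel)"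
    by (simp add: nn_integral_restrict_space)
  also have "\<dots> \<le> (\<integral>\<^sup>+y. ?h (x + - 1 * y) + ?h (- x + 1 * y) \<partial>lborel)"
    using x by (intro nn_integral_mono) (auto simp: indicator_def abs_if)
  also have "\<dots> = ennreal (1 / (1 - s)) + ennreal (1 / (1 - s))"
    by (subst nn_integral_add) (simp_all only: affine, measurable)
  also have "\<dots> = ennreal (2 / (1 - s))"
    using assms(1) by (subst ennreal_plus[symmetric]) auto
  finally show ?thesis .
qed

text \<open>Both factors only grow when \<open>u\<close> and \<open>v\<close> are replaced by their minimum. This separates the two
  singularities of the kernel, at the cost of adding the exponents.\<close>

lemma powr_mult_powr_le_sum:
  fixes p q u v :: real
  assumes "0 \<le> p" "0 \<le> q" "0 < u" "0 < v"
  shows "u powr (- p) * v powr (- q) \<le> u powr (- (p + q)) + v powr (- (p + q))"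
proof -
  define m where "m = min u v"
  have "u powr (- p) \<le> m powr (- p)" "v powr (- q) \<le> m powr (- q)"
    using assms by (auto simp: m_def intro!: powr_mono2')
  then have "u powr (- p) * v powr (- q) \<le> m powr (- p) * m powr (- q)"
    by (intro mult_mono) auto
  also have "\<dots> = m powr (- (p + q))"
    by (simp add: powr_add[symmetric])
  also have "\<dots> \<le> u powr (- (p + q)) + v powr (- (p + q))"
    by (auto simp: m_def min_def)
  finally show ?thesis .
qed

lemma AE_unit_lborel: "(AE x in unit_lborel. 0 < x \<and> x < 1 \<and> x \<noteq> c)"
  by (subst AE_restrict_space_iff) (use AE_lborel_singleton[of c] in auto)

lemma emeasure_unit_lborel: "emeasure unit_lborel (space unit_lborel) = 1"
  by (simp add: space_restrict_space emeasure_restrict_space)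

lemma prob_space_unit_lborel: "prob_space unit_lborel"
  by (rule prob_spaceI) (rule emeasure_unit_lborel)

text \<open>The kernel is strictly positive off the diagonal, so only integrability is at stake. With
  \<open>s = max d 0 + 2 \<alpha>\<close>, the product \<open>y powr (- d) * \<bar>x - y\<bar> powr (- 2 * \<alpha>)\<close> is at most
  \<open>y powr (- s) + \<bar>x - y\<bar> powr (- s)\<close>, and \<open>s < 1\<close>: for \<open>d < 0\<close> because \<open>2 \<alpha> < 1\<close>, for \<open>d \<ge> 0\<close> because
  \<open>d + 2 \<alpha> = (d + \<alpha>) + \<alpha> < 1/2 + 1/2\<close>. Thus the inner integral is at most a constant times
  \<open>x powr (- d)\<close>, which is integrable as \<open>d < 1/2\<close>.\<close>

lemma I2_pos:
  fixes \<alpha> d :: real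
  assumes "0 < \<alpha>" "\<alpha> < 1 / 2" "2 * d + 2 * \<alpha> < 1"
  shows "0 < I2 \<alpha> d"
proof -
  interpret U: prob_space unit_lborel by (rule prob_space_unit_lborel)
  define k where "k x y = x powr (- d) * y powr (- d) * \<bar>x - y\<bar> powr (- 2 * \<alpha>)" for x y :: real
  have borel_imp_unit: "h \<in> borel_measurable unit_lborel" if "h \<in> borel_measurable borel" for h :: "real \<Rightarrow> real"
    using that by (intro measurable_restrict_space1) simp
  have id [measurable]: "(\<lambda>x. x) \<in> borel_measurable unit_lborel"
    by (rule borel_imp_unit) simp
  have [measurable]: "fst \<in> borel_measurable (unit_lborel \<Otimes>\<^sub>M unit_lborel)"
    "snd \<in> borel_measurable (unit_lborel \<Otimes>\<^sub>M unit_lborel)"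
    using measurable_compose[OF measurable_fst id] measurable_compose[OF measurable_snd id] by simp_all
  have k_measurable [measurable]: "case_prod k \<in> borel_measurable (unit_lborel \<Otimes>\<^sub>M unit_lborel)"
    unfolding k_def[abs_def] split_beta' by measurable
  have k_nonneg: "0 \<le> k x y" for x y
    by (simp add: k_def)
  define s where "s = max d 0 + 2 * \<alpha>"
  have s: "s < 1" "d < 1"
    using assms by (auto simp: s_def max_def)
  define C where "C = 1 / (1 - s) + 2 / (1 - s)"
  have inner: "(\<integral>\<^sup>+y. ennreal (k x y) \<partial>unit_lborel) \<le> ennreal (C * x powr (- d))" if x: "0 < x" "x < 1" for x
  proof -
    have "(\<integral>\<^sup>+y. ennreal (k x y) \<partial>unit_lborel)
        \<le> (\<integral>\<^sup>+y. ennreal (x powr (- d)) * (ennreal (y powr (- s)) + ennreal (\<bar>x - y\<bar> powr (- s))) \<partial>unit_lborel)"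
    proof (intro nn_integral_mono_AE, use AE_unit_lborel[of x] in eventually_elim)
      case (elim y)
      have "y powr (- d) * \<bar>x - y\<bar> powr (- 2 * \<alpha>) \<le> y powr (- max d 0) * \<bar>x - y\<bar> powr (- (2 * \<alpha>))"
        using elim by (intro mult_mono) (auto intro!: powr_mono')
      also have "\<dots> \<le> y powr (- s) + \<bar>x - y\<bar> powr (- s)"
        unfolding s_def using elim assms by (intro powr_mult_powr_le_sum) auto
      finally have "k x y \<le> x powr (- d) * (y powr (- s) + \<bar>x - y\<bar> powr (- s))"
        unfolding k_def mult.assoc by (intro mult_left_mono) auto
      then show ?case
        by (simp add: ennreal_leI ennreal_mult'[symmetric] ennreal_plus[symmetric] del: ennreal_plus)
    qed
    also have "\<dots> = ennreal (x powr (- d)) * ((\<integral>\<^sup>+y. ennreal (y powr (- s)) \<partial>unit_lborel)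
        + (\<integral>\<^sup>+y. ennreal (\<bar>x - y\<bar> powr (- s)) \<partial>unit_lborel))"
      by (simp add: nn_integral_cmult nn_integral_add)
    also have "\<dots> \<le> ennreal (x powr (- d)) * (ennreal (1 / (1 - s)) + ennreal (2 / (1 - s)))"
      using nn_integral_powr_unit[OF s(1)] nn_integral_powr_diff_unit_le[OF s(1) x]
      by (intro mult_left_mono add_mono) auto
    also have "\<dots> = ennreal (C * x powr (- d))"
      unfolding C_def using s(1)
      by (subst ennreal_plus[symmetric]) (auto simp: ennreal_mult'[symmetric] mult.commute)
    finally show ?thesis .
  qed
  have inner_integrable: "integrable unit_lborel (k x)" if x: "0 < x" "x < 1" for x
  proof (rule integrableI_bounded)
    have "(\<integral>\<^sup>+y. ennreal (norm (k x y)) \<partial>unit_lborel) = (\<integral>\<^sup>+y. ennreal (k x y) \<partial>unit_lborel)"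
      by (simp add: k_def)
    then show "(\<integral>\<^sup>+y. ennreal (norm (k x y)) \<partial>unit_lborel) < \<infinity>"
      using inner[OF x] by (simp add: le_less_trans[OF _ ennreal_less_top])
  qed (unfold k_def[abs_def], intro borel_imp_unit, measurable)
  define g where "g x = (\<integral>y. k x y \<partial>unit_lborel)" for x
  have [measurable]: "g \<in> borel_measurable unit_lborel"
    unfolding g_def[abs_def] by measurable
  have g_pos: "0 < g x" if x: "0 < x" "x < 1" for x
  proof -
    have "(\<integral>y. 0 \<partial>unit_lborel) < (\<integral>y. k x y \<partial>unit_lborel)"
    proof (rule U.integral_less_AE_space[OF _ inner_integrable[OF x]])
      show "AE y in unit_lborel. 0 < k x y"
        using AE_unit_lborel[of x] by eventually_elim (use x in \<open>auto simp: k_def\<close>)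
    qed (use emeasure_unit_lborel in simp_all)
    then show ?thesis by (simp add: g_def)
  qed
  have g_integrable: "integrable unit_lborel g"
  proof (rule integrableI_bounded)
    have "(\<integral>\<^sup>+x. ennreal (norm (g x)) \<partial>unit_lborel) \<le> (\<integral>\<^sup>+x. ennreal C * ennreal (x powr (- d)) \<partial>unit_lborel)"
    proof (intro nn_integral_mono_AE, use AE_unit_lborel[of 0] in eventually_elim)
      case (elim x)
      then have "ennreal (norm (g x)) = (\<integral>\<^sup>+y. ennreal (k x y) \<partial>unit_lborel)"
        using g_pos[of x] inner_integrable[of x]
        by (subst nn_integral_eq_integral) (auto simp: g_def k_nonneg)
      also have "\<dots> \<le> ennreal (C * x powr (- d))"
        using elim by (intro inner) auto
      finally show ?case
        by (simp add: ennreal_mult'')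
    qed
    also have "\<dots> < \<infinity>"
      using nn_integral_powr_unit[OF s(2)] by (simp add: nn_integral_cmult ennreal_mult_less_top)
    finally show "(\<integral>\<^sup>+x. ennreal (norm (g x)) \<partial>unit_lborel) < \<infinity>" .
  qed measurable
  have "(\<integral>x. 0 \<partial>unit_lborel) < (\<integral>x. g x \<partial>unit_lborel)"
  proof (rule U.integral_less_AE_space[OF _ g_integrable])
    show "AE x in unit_lborel. 0 < g x"
      using AE_unit_lborel[of 0] by eventually_elim (auto intro: g_pos)
  qed (use emeasure_unit_lborel in simp_all)
  then show ?thesis
    by (simp add: I2_def g_def k_def)
qed

section \<open>Moments and tails of the second-chaos limit\<close>

theorem proposition3p1:
  fixes \<alpha> d :: real
    and \<mu> :: "nat \<Rightarrow> real"
    and N :: "'b measure" and Z :: "nat \<Rightarrow> 'b \<Rightarrow> real" and W :: "'b \<Rightarrow> real"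
    and M :: "'a measure" and Y :: "'a \<Rightarrow> real"
  assumes "0 < \<alpha>" and "\<alpha> < 1/2" and "2 * d + 2 * \<alpha> < 1"
    and "eigenvalue_sequence \<alpha> d \<mu>"
    and "prob_space N"
    and "prob_space.indep_vars N (\<lambda>_. borel) Z UNIV"
    and "\<And>j. distributed N lborel (Z j) std_normal_density"
    and "W \<in> borel_measurable N"
    and "AE \<omega> in N. (\<lambda>j. chaos_coeff \<alpha> d \<mu> j * ((Z j \<omega>)\<^sup>2 - 1)) sums W \<omega>"
    and "prob_space M"
    and "Y \<in> borel_measurable M"
    and "distr M borel Y = distr N borel W"
  shows "(\<forall>t::real. (\<integral>\<^sup>+\<omega>. ennreal (exp (t * Y \<omega>)) \<partial>M) < \<infinity> \<longleftrightarrow> t < 1 / (2 * Lambda2 \<alpha> d))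
    \<and> ((\<lambda>x::real. 1 / x * ln (measure M {\<omega> \<in> space M. Y \<omega> > x}))
          \<longlongrightarrow> - (1 / (2 * Lambda2 \<alpha> d))) at_top
    \<and> ((\<lambda>x::real. 1 / x * ln (measure M {\<omega> \<in> space M. \<bar>Y \<omega>\<bar> > x}))
          \<longlongrightarrow> - (1 / (2 * Lambda2 \<alpha> d))) at_top"
proof -
  have \<mu>: "decseq \<mu>" "\<And>j. 0 < \<mu> j"
    using assms(4) by (auto simp: eigenvalue_sequence_def)
  have I2: "0 < I2 \<alpha> d"
    by (rule I2_pos[OF assms(1-3)])
  interpret prob_space N by fact
  interpret decreasing_chi_square_series N Z "chaos_coeff \<alpha> d \<mu>" W
  proof unfold_locales
    show "0 < chaos_coeff \<alpha> d \<mu> j" for j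
      using \<mu>(2)[of j] I2 by (simp add: chaos_coeff_def)
    show "decseq (chaos_coeff \<alpha> d \<mu>)"
      using \<mu>(1) I2 by (auto simp: decseq_def chaos_coeff_def intro!: divide_right_mono)
  qed (fact assms)+
  have top: "chaos_coeff \<alpha> d \<mu> 0 = Lambda2 \<alpha> d"
    by (simp add: chaos_coeff_def Lambda2_def lambda_max_eq[OF assms(4)])
  note [measurable] = assms(11)
  have exp_eq: "(\<integral>\<^sup>+\<omega>. ennreal (exp (t * Y \<omega>)) \<partial>M) = (\<integral>\<^sup>+\<omega>. ennreal (exp (t * W \<omega>)) \<partial>N)" for t
  proof -
    have "(\<integral>\<^sup>+\<omega>. ennreal (exp (t * Y \<omega>)) \<partial>M) = (\<integral>\<^sup>+y. ennreal (exp (t * y)) \<partial>distr M borel Y)"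
      by (simp add: nn_integral_distr)
    also have "\<dots> = (\<integral>\<^sup>+\<omega>. ennreal (exp (t * W \<omega>)) \<partial>N)"
      unfolding assms(12) by (simp add: nn_integral_distr)
    finally show ?thesis .
  qed
  have measure_eq: "measure M {\<omega> \<in> space M. Y \<omega> \<in> A} = measure N {\<omega> \<in> space N. W \<omega> \<in> A}"
    if "A \<in> sets borel" for A
  proof -
    have "measure M {\<omega> \<in> space M. Y \<omega> \<in> A} = measure (distr M borel Y) A"
      using that by (subst measure_distr) (auto intro: arg_cong[where f = "measure M"])
    also have "\<dots> = measure N {\<omega> \<in> space N. W \<omega> \<in> A}"
      unfolding assms(12) using that
      by (subst measure_distr) (auto intro: arg_cong[where f = "measure N"])
    finally show ?thesis .
  qed
  have "measure M {\<omega> \<in> space M. Y \<omega> > x} = measure N {\<omega> \<in> space N. x < W \<omega>}" for x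
    using measure_eq[of "{x<..}"] by simp
  moreover have "measure M {\<omega> \<in> space M. \<bar>Y \<omega>\<bar> > x} = measure N {\<omega> \<in> space N. x < \<bar>W \<omega>\<bar>}" for x
    using measure_eq[of "{y. x < \<bar>y\<bar>}"] by simp
  ultimately show ?thesis
    using nn_integral_exp_finite_iff upper_tail_limits by (simp add: exp_eq top)
qed

end
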